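(* For any Tychonoff space $X$, the following are equivalent: (i) $X$ is not hemicompact. (ii) $C_k(X)$ is not metrizable. (iii) $C_k(X)$ is injectively discretely selective. (iv) $C_k(X)$ is discretely selective. (v) $C_k(X)$ is SHD. (vi) $C_k(X)$ is WSHD.
   Context: $\mathbb N$ is the set of positive integers. A space is a nonempty topological space; Tychonoff spaces are $T_1$. $X$ is hemicompact if there is a countable family of compact subsets of $X$ such that every compact subset of $X$ is contained in a member of the family. $C_k(X)$ is the set of continuous real-valued functions on $X$ with the topology of uniform convergence on compact subsets of $X$. For a space $Y$: a subset $A\subseteq Y$ is closed and relatively discrete if it is closed and for every $y\in A$ there is an open $U$ with $U\cap A=\{y\}$. $Y$ is discretely selective if for every sequence $\langle U_n:n\in\mathbb N\rangle$ of nonempty open subsets of $Y$ there are $y_n\in U_n$ such that $\{y_n:n\in\mathbb N\}$ is closed and relatively discrete in $Y$; injectively discretely selective if moreover the $y_n$ can always be chosen with $n\mapsto y_n$ injective. $Y$ is SHD (selectively highly divergent) if for every such sequence there are $y_n\in U_n$ such that $\langle y_n:n\in\mathbb N\rangle$ has no convergent subsequence. $Y$ is WSHD (weakly selectively highly divergent) if for every such sequence there are an infinite $A\subseteq\mathbb N$ and $y_n\in U_n$ for $n\in A$ such that $\langle y_n:n\in A\rangle$ has no convergent subsequence. *)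

theory Defs
  imports "HOL-Analysis.Analysis"
begin

definition tychonoff_space :: "'a topology \<Rightarrow> bool" where
  "tychonoff_space X \<longleftrightarrow> completely_regular_space X \<and> t1_space X"

definition hemicompact_space :: "'a topology \<Rightarrow> bool" where
  "hemicompact_space X \<longleftrightarrow>
    (\<exists>\<K>. countable \<K> \<and> (\<forall>K\<in>\<K>. compactin X K) \<and>
         (\<forall>C. compactin X C \<longrightarrow> (\<exists>K\<in>\<K>. C \<subseteq> K)))"

text \<open>A function on the carrier \<open>topspace X\<close> is represented by the one total function
  that takes the value \<open>undefined\<close> outside the carrier.\<close>

definition continuous_real_functions :: "'a topology \<Rightarrow> ('a \<Rightarrow> real) set" where
  "continuous_real_functions X =
    {f. continuous_map X euclideanreal f \<and> f \<in> extensional (topspace X)}"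

definition Ck_nbhd :: "'a topology \<Rightarrow> ('a \<Rightarrow> real) \<Rightarrow> 'a set \<Rightarrow> real \<Rightarrow> ('a \<Rightarrow> real) set" where
  "Ck_nbhd X f K \<epsilon> = {g \<in> continuous_real_functions X. \<forall>x\<in>K. \<bar>g x - f x\<bar> < \<epsilon>}"

text \<open>The sets \<open>Ck_nbhd X f K \<epsilon>\<close>, for compact \<open>K\<close> and positive \<open>\<epsilon>\<close>, form a
  neighbourhood base at \<open>f\<close> for the topology of uniform convergence on compact sets.\<close>

definition Ck_space :: "'a topology \<Rightarrow> ('a \<Rightarrow> real) topology" where
  "Ck_space X = topology (\<lambda>W. W \<subseteq> continuous_real_functions X \<and>
     (\<forall>f\<in>W. \<exists>K \<epsilon>. compactin X K \<and> 0 < \<epsilon> \<and> Ck_nbhd X f K \<epsilon> \<subseteq> W))"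

lemma openin_Ck_space:
  "openin (Ck_space X) W \<longleftrightarrow> W \<subseteq> continuous_real_functions X \<and>
     (\<forall>f\<in>W. \<exists>K \<epsilon>. compactin X K \<and> 0 < \<epsilon> \<and> Ck_nbhd X f K \<epsilon> \<subseteq> W)"
proof -
  let ?P = "\<lambda>W. W \<subseteq> continuous_real_functions X \<and>
     (\<forall>f\<in>W. \<exists>K \<epsilon>. compactin X K \<and> 0 < \<epsilon> \<and> Ck_nbhd X f K \<epsilon> \<subseteq> W)"
  have "istopology ?P"
    unfolding istopology_def
  proof (intro conjI allI impI)
    fix S T assume S: "?P S" and T: "?P T"
    have "\<exists>K \<epsilon>. compactin X K \<and> 0 < \<epsilon> \<and> Ck_nbhd X f K \<epsilon> \<subseteq> S \<inter> T"
      if f: "f \<in> S \<inter> T" for f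
    proof -
      obtain K a where K: "compactin X K" "0 < a" "Ck_nbhd X f K a \<subseteq> S"
        using S f by blast
      obtain L b where L: "compactin X L" "0 < b" "Ck_nbhd X f L b \<subseteq> T"
        using T f by blast
      have "Ck_nbhd X f (K \<union> L) (min a b) \<subseteq> Ck_nbhd X f K a \<inter> Ck_nbhd X f L b"
        by (auto simp: Ck_nbhd_def)
      moreover have "compactin X (K \<union> L)"
        using K L by (simp add: compactin_Un)
      ultimately show ?thesis
        using K L by (intro exI[of _ "K \<union> L"] exI[of _ "min a b"]) auto
    qed
    then show "S \<inter> T \<subseteq> continuous_real_functions X"
      "\<forall>f\<in>S \<inter> T. \<exists>K \<epsilon>. compactin X K \<and> 0 < \<epsilon> \<and> Ck_nbhd X f K \<epsilon> \<subseteq> S \<inter> T"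
      using S by auto
  next
    fix \<W> assume W: "\<forall>W\<in>\<W>. ?P W"
    then show "\<Union>\<W> \<subseteq> continuous_real_functions X" by blast
    show "\<forall>f\<in>\<Union>\<W>. \<exists>K \<epsilon>. compactin X K \<and> 0 < \<epsilon> \<and> Ck_nbhd X f K \<epsilon> \<subseteq> \<Union>\<W>"
    proof
      fix f assume "f \<in> \<Union>\<W>"
      then obtain W where "W \<in> \<W>" "f \<in> W" by blast
      with W obtain K \<epsilon> where "compactin X K" "0 < \<epsilon>" "Ck_nbhd X f K \<epsilon> \<subseteq> W"
        by blast
      with \<open>W \<in> \<W>\<close> show "\<exists>K \<epsilon>. compactin X K \<and> 0 < \<epsilon> \<and> Ck_nbhd X f K \<epsilon> \<subseteq> \<Union>\<W>"
        by blast
    qed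
  qed
  then show ?thesis
    by (simp add: Ck_space_def)
qed

lemma topspace_Ck_space [simp]: "topspace (Ck_space X) = continuous_real_functions X"
proof
  show "topspace (Ck_space X) \<subseteq> continuous_real_functions X"
    using openin_topspace[of "Ck_space X"] by (simp only: openin_Ck_space)
  have "openin (Ck_space X) (continuous_real_functions X)"
    unfolding openin_Ck_space
    by (auto simp: Ck_nbhd_def intro!: exI[of _ "{}"] exI[of _ "1::real"])
  then show "continuous_real_functions X \<subseteq> topspace (Ck_space X)"
    by (rule openin_subset)
qed

definition closed_relatively_discrete :: "'b topology \<Rightarrow> 'b set \<Rightarrow> bool" where
  "closed_relatively_discrete Y A \<longleftrightarrow>
    closedin Y A \<and> (\<forall>y\<in>A. \<exists>U. openin Y U \<and> U \<inter> A = {y})"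

text \<open>Sequences are indexed by \<^typ>\<open>nat\<close>, hence start at \<open>0\<close> instead of \<open>1\<close>.\<close>

definition discretely_selective :: "'b topology \<Rightarrow> bool" where
  "discretely_selective Y \<longleftrightarrow>
    (\<forall>U :: nat \<Rightarrow> 'b set. (\<forall>n. openin Y (U n) \<and> U n \<noteq> {}) \<longrightarrow>
      (\<exists>y. (\<forall>n. y n \<in> U n) \<and> closed_relatively_discrete Y (range y)))"

definition injectively_discretely_selective :: "'b topology \<Rightarrow> bool" where
  "injectively_discretely_selective Y \<longleftrightarrow>
    (\<forall>U :: nat \<Rightarrow> 'b set. (\<forall>n. openin Y (U n) \<and> U n \<noteq> {}) \<longrightarrow>
      (\<exists>y. (\<forall>n. y n \<in> U n) \<and> closed_relatively_discrete Y (range y) \<and> inj y))"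

text \<open>Only the values of \<open>y\<close> on \<open>A\<close> matter: this is about the sequence
  \<open>\<langle>y n : n \<in> A\<rangle>\<close>, whose subsequences are given by the strictly increasing
  index sequences in \<open>A\<close>.\<close>

definition has_convergent_subsequence_on :: "'b topology \<Rightarrow> nat set \<Rightarrow> (nat \<Rightarrow> 'b) \<Rightarrow> bool" where
  "has_convergent_subsequence_on Y A y \<longleftrightarrow>
    (\<exists>r l. strict_mono r \<and> range r \<subseteq> A \<and> limitin Y (y \<circ> r) l sequentially)"

definition SHD :: "'b topology \<Rightarrow> bool" where
  "SHD Y \<longleftrightarrow>
    (\<forall>U :: nat \<Rightarrow> 'b set. (\<forall>n. openin Y (U n) \<and> U n \<noteq> {}) \<longrightarrow>
      (\<exists>y. (\<forall>n. y n \<in> U n) \<and> \<not> has_convergent_subsequence_on Y UNIV y))"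

definition WSHD :: "'b topology \<Rightarrow> bool" where
  "WSHD Y \<longleftrightarrow>
    (\<forall>U :: nat \<Rightarrow> 'b set. (\<forall>n. openin Y (U n) \<and> U n \<noteq> {}) \<longrightarrow>
      (\<exists>A y. infinite A \<and> (\<forall>n\<in>A. y n \<in> U n) \<and> \<not> has_convergent_subsequence_on Y A y))"

end

theory Submission imports Defs begin

text \<open>Suppose \<open>X\<close> is not hemicompact and basic open sets given by \<open>f\<^sub>n, K\<^sub>n, \<epsilon>\<^sub>n\<close> are prescribed.
  Some compact \<open>C\<close> is contained in no \<open>K\<^sub>n\<close>, so \<open>f\<^sub>n\<close> can be changed off \<open>K\<^sub>n\<close> to be at
  least \<open>n\<close> at a point of \<open>C\<close>. Since functions are bounded on \<open>C\<close>, every point of \<open>C\<^sub>k(X)\<close> has a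
  neighbourhood containing only finitely many of the changed functions, which thus form a closed
  relatively discrete set. Conversely, if \<open>X\<close> is hemicompact, as witnessed by \<open>K\<^sub>n\<close>, then
  \<open>C\<^sub>k(X)\<close> is metrized by the supremum over \<open>x\<close> of \<open>min (w x) \<bar>f x - g x\<bar>\<close>, where
  \<open>w x = 1/(n+1)\<close> for the least \<open>n\<close> with \<open>x \<in> K\<^sub>n\<close>; and in a metrizable space without isolated points the selection properties fail for the balls of
  radius \<open>1/(n+1)\<close> around a point.\<close>

text \<open>On the compact set the difference attains its maximum, which leaves room for a smaller
  neighbourhood.\<close>

lemma openin_Ck_nbhd:
  assumes "compactin X K" "f \<in> continuous_real_functions X"
  shows "openin (Ck_space X) (Ck_nbhd X f K \<epsilon>)"
  unfolding openin_Ck_space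
proof (intro conjI ballI)
  show "Ck_nbhd X f K \<epsilon> \<subseteq> continuous_real_functions X"
    by (auto simp: Ck_nbhd_def)
  fix g assume g: "g \<in> Ck_nbhd X f K \<epsilon>"
  have "\<exists>\<delta>>0. \<forall>x\<in>K. \<bar>g x - f x\<bar> + \<delta> \<le> \<epsilon>"
  proof (cases "K = {}")
    case False
    have "continuous_map X euclideanreal (\<lambda>x. \<bar>g x - f x\<bar>)"
      using g assms(2)
      by (intro continuous_map_real_abs continuous_map_diff)
        (auto simp: Ck_nbhd_def continuous_real_functions_def)
    with assms(1) have "compactin euclideanreal ((\<lambda>x. \<bar>g x - f x\<bar>) ` K)"
      by (rule image_compactin)
    then obtain s where s: "s \<in> (\<lambda>x. \<bar>g x - f x\<bar>) ` K" "\<And>t. t \<in> (\<lambda>x. \<bar>g x - f x\<bar>) ` K \<Longrightarrow> t \<le> s"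
      using compact_attains_sup[of "(\<lambda>x. \<bar>g x - f x\<bar>) ` K"] False by auto
    moreover have "s < \<epsilon>"
      using s(1) g by (auto simp: Ck_nbhd_def)
    ultimately show ?thesis
      by (intro exI[of _ "\<epsilon> - s"]) auto
  qed (auto intro: exI[of _ 1])
  then obtain \<delta> where \<delta>: "\<delta> > 0" "\<And>x. x \<in> K \<Longrightarrow> \<bar>g x - f x\<bar> + \<delta> \<le> \<epsilon>"
    by blast
  have "Ck_nbhd X g K \<delta> \<subseteq> Ck_nbhd X f K \<epsilon>"
    using \<delta>(2) by (force simp: Ck_nbhd_def)
  with assms(1) \<delta>(1) show "\<exists>K' \<epsilon>'. compactin X K' \<and> 0 < \<epsilon>' \<and> Ck_nbhd X g K' \<epsilon>' \<subseteq> Ck_nbhd X f K \<epsilon>"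
    by blast
qed

lemma continuous_real_functions_restrict:
  assumes "continuous_map X euclideanreal f"
  shows "restrict f (topspace X) \<in> continuous_real_functions X"
  using assms continuous_map_eq[of X euclideanreal f "restrict f (topspace X)"]
  by (simp add: continuous_real_functions_def)

subsection \<open>Hemicompact spaces\<close>

lemma metrizable_Ck_space:
  assumes ne: "topspace X \<noteq> {}" and "hemicompact_space X"
  shows "metrizable_space (Ck_space X)"
proof -
  obtain \<K> where \<K>: "countable \<K>" "\<And>K. K \<in> \<K> \<Longrightarrow> compactin X K"
    "\<And>C. compactin X C \<Longrightarrow> \<exists>K\<in>\<K>. C \<subseteq> K"
    using assms(2) unfolding hemicompact_space_def by blast
  have "\<K> \<noteq> {}"
    using \<K>(3)[of "{}"] by auto
  define K where "K = from_nat_into \<K>"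
  have K: "compactin X (K n)" for n
    using \<K>(2) \<open>\<K> \<noteq> {}\<close> by (simp add: K_def from_nat_into)
  have cover: "\<exists>n. C \<subseteq> K n" if "compactin X C" for C
    using \<K>(3)[OF that] from_nat_into_surj[OF \<K>(1)] unfolding K_def by metis
  define N where "N x = (LEAST n. x \<in> K n)" for x
  define w where "w x = inverse (real (Suc (N x)))" for x
  \<comment> \<open>Truncating at \<open>w x\<close> keeps the supremum finite for unbounded
    functions.\<close>
  define d where "d f g = (SUP x\<in>topspace X. min (w x) \<bar>f x - g x\<bar>)" for f g :: "'a \<Rightarrow> real"
  have in_K: "x \<in> K (N x)" if "x \<in> topspace X" for x
    using cover[of "{x}"] that unfolding N_def by (auto intro: LeastI)
  have w_pos: "0 < w x" and w_le1: "w x \<le> 1" for x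
    by (auto simp: w_def field_simps)
  have w_ge: "inverse (real (Suc n)) \<le> w x" if "x \<in> K n" for x n
    using Least_le[of "\<lambda>n. x \<in> K n" n] that unfolding w_def N_def
    by (intro le_imp_inverse_le) auto
  have bdd: "bdd_above ((\<lambda>x. min (w x) \<bar>f x - g x\<bar>) ` topspace X)" for f g :: "'a \<Rightarrow> real"
    using w_le1 by (intro bdd_aboveI2[of _ _ 1]) (simp add: min.coboundedI1)
  have d_ge: "min (w x) \<bar>f x - g x\<bar> \<le> d f g" if "x \<in> topspace X" for x f g
    unfolding d_def by (rule cSUP_upper[OF that bdd])
  have d_le: "d f g \<le> e" if "\<And>x. x \<in> topspace X \<Longrightarrow> min (w x) \<bar>f x - g x\<bar> \<le> e" for f g e
    unfolding d_def by (rule cSUP_least[OF ne that])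
  have d_nonneg: "0 \<le> d f g" for f g
  proof -
    obtain x where "x \<in> topspace X"
      using ne by blast
    then show ?thesis
      using d_ge[of x f g] w_pos[of x] by linarith
  qed
  interpret M: Metric_space "continuous_real_functions X" d
  proof
    fix f g show "0 \<le> d f g"
      by (rule d_nonneg)
    show "d f g = d g f"
      by (simp add: d_def abs_minus_commute)
  next
    fix f g assume fg: "f \<in> continuous_real_functions X" "g \<in> continuous_real_functions X"
    show "d f g = 0 \<longleftrightarrow> f = g"
    proof
      assume "d f g = 0"
      then have "f x = g x" if "x \<in> topspace X" for x
        using d_ge[OF that, of f g] w_pos[of x] by (simp add: min_le_iff_disj)
      with fg show "f = g"
        unfolding continuous_real_functions_def by (auto intro: extensionalityI)
    next
      assume "f = g"
      then have "d f g \<le> 0"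
        by (intro d_le) simp
      with d_nonneg[of f g] show "d f g = 0"
        by simp
    qed
  next
    fix f g h
    show "d f h \<le> d f g + d g h"
    \<comment> \<open>For a fixed weight, t \<mapsto> \<open>min (w x) t\<close> is increasing and
      subadditive on t \<ge> 0, so the triangle inequality holds at each point.\<close>
    proof (rule d_le)
      fix x assume "x \<in> topspace X"
      then have "min (w x) \<bar>f x - g x\<bar> \<le> d f g" "min (w x) \<bar>g x - h x\<bar> \<le> d g h"
        by (auto intro: d_ge)
      with w_pos[of x] show "min (w x) \<bar>f x - h x\<bar> \<le> d f g + d g h"
        by linarith
    qed
  qed
  have nbhd_in_ball: "\<exists>C e. compactin X C \<and> 0 < e \<and> Ck_nbhd X f C e \<subseteq> M.mball f r"
    if f: "f \<in> continuous_real_functions X" and "0 < r" for f r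
  proof -
    \<comment> \<open>Points outside \<open>K 0\<close>, ..., \<open>K m\<close> have weight below
      \<open>r / 2\<close>, whatever the functions do there, so closeness on this finite union is
      enough. The halving compensates for the supremum, which yields only \<le>.\<close>
    obtain m where m: "inverse (real (Suc m)) < r / 2"
      using reals_Archimedean[of "r / 2"] \<open>0 < r\<close> by auto
    have C: "compactin X (\<Union>n\<le>m. K n)"
      using K by (intro compactin_Union) auto
    have "g \<in> M.mball f r" if g: "g \<in> Ck_nbhd X f (\<Union>n\<le>m. K n) (r / 2)" for g
    proof -
      have "d f g \<le> r / 2"
      proof (rule d_le)
        fix x assume x: "x \<in> topspace X"
        show "min (w x) \<bar>f x - g x\<bar> \<le> r / 2"
        proof (cases "N x \<le> m")
          case True
          then have "\<bar>g x - f x\<bar> < r / 2"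
            using g in_K[OF x] unfolding Ck_nbhd_def by blast
          then show ?thesis
            by linarith
        next
          case False
          then have "w x \<le> inverse (real (Suc m))"
            unfolding w_def by (intro le_imp_inverse_le) auto
          with m show ?thesis
            by linarith
        qed
      qed
      with f g \<open>0 < r\<close> show ?thesis
        by (auto simp: Ck_nbhd_def)
    qed
    with C \<open>0 < r\<close> show ?thesis
      by (intro exI[of _ "\<Union>n\<le>m. K n"] exI[of _ "r / 2"]) auto
  qed
  have ball_in_nbhd: "\<exists>r>0. M.mball f r \<subseteq> Ck_nbhd X f C e"
    if C: "compactin X C" and "0 < e" for f C e
  proof -
    obtain n where n: "C \<subseteq> K n"
      using cover[OF C] by blast
    \<comment> \<open>On \<open>K n\<close> the weights are at least 1/(n+1), so at a distance below
      this bound the truncation is not active on \<open>C\<close>.\<close>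
    have "g \<in> Ck_nbhd X f C e" if g: "g \<in> M.mball f (min (inverse (real (Suc n))) e)" for g
    proof -
      have "\<bar>g x - f x\<bar> < e" if "x \<in> C" for x
      proof -
        have "x \<in> topspace X"
          using C compactin_subset_topspace that by blast
        from d_ge[OF this, of f g] w_ge[of x n] g n that show ?thesis
          by (auto simp: abs_minus_commute)
      qed
      with g show ?thesis
        by (auto simp: Ck_nbhd_def)
    qed
    with \<open>0 < e\<close> show ?thesis
      by (intro exI[of _ "min (inverse (real (Suc n))) e"]) auto
  qed
  have "Ck_space X = M.mtopology"
    unfolding topology_eq openin_Ck_space M.openin_mtopology
    using nbhd_in_ball ball_in_nbhd by (meson subset_iff)
  then show ?thesis
    using M.metrizable_space_mtopology by simp
qed

subsection \<open>Metrizable spaces\<close>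

text \<open>The balls of radius 1/(n+1) work because r(n) \<ge> n. Only values of \<open>y\<close>
  along \<open>r\<close> enter, so the lemma applies to selections on an infinite index set as well
  as to full ones.\<close>

lemma metrizable_shrinking_balls:
  assumes "metrizable_space Y" "a \<in> topspace Y"
  obtains B :: "nat \<Rightarrow> 'b set" where "\<And>n. openin Y (B n)" "\<And>n. a \<in> B n"
    "\<And>r y. \<lbrakk>strict_mono r; \<And>n. y (r n) \<in> B (r n)\<rbrakk> \<Longrightarrow> limitin Y (y \<circ> r) a sequentially"
proof -
  obtain M d where M: "Metric_space M d" and Y: "Y = Metric_space.mtopology M d"
    using assms(1) unfolding metrizable_space_def by blast
  interpret Metric_space M d
    by (rule M)
  have a: "a \<in> M"
    using assms(2) by (simp add: Y)
  define B where "B n = mball a (inverse (real (Suc n)))" for n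
  have "limitin Y (y \<circ> r) a sequentially"
    if r: "strict_mono r" and y: "\<And>n. y (r n) \<in> B (r n)" for r :: "nat \<Rightarrow> nat" and y
    unfolding Y limitin_metric
  proof (intro conjI allI impI)
    fix \<epsilon> :: real assume "0 < \<epsilon>"
    then obtain m where m: "inverse (real (Suc m)) < \<epsilon>"
      using reals_Archimedean by blast
    have "(y \<circ> r) n \<in> M \<and> d ((y \<circ> r) n) a < \<epsilon>" if "m \<le> n" for n
    proof -
      have "m \<le> r n"
        using that seq_suble[OF r, of n] by linarith
      then have "inverse (real (Suc (r n))) \<le> inverse (real (Suc m))"
        by (intro le_imp_inverse_le) auto
      then have "inverse (real (Suc (r n))) < \<epsilon>"
        using m by (rule le_less_trans)
      with y[of n] show ?thesis
        by (auto simp: B_def commute simp del: of_nat_Suc)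
    qed
    then show "\<forall>\<^sub>F n in sequentially. (y \<circ> r) n \<in> M \<and> d ((y \<circ> r) n) a < \<epsilon>"
      using eventually_sequentially by blast
  qed (rule a)
  moreover have "openin Y (B n)" "a \<in> B n" for n
    using a by (auto simp: Y B_def)
  ultimately show thesis
    using that by blast
qed

lemma metrizable_imp_not_WSHD:
  assumes "metrizable_space Y" "topspace Y \<noteq> {}"
  shows "\<not> WSHD Y"
proof
  assume W: "WSHD Y"
  obtain a where "a \<in> topspace Y"
    using assms(2) by blast
  then obtain B :: "nat \<Rightarrow> 'a set" where B: "\<And>n. openin Y (B n)" "\<And>n. a \<in> B n"
    "\<And>r y. \<lbrakk>strict_mono r; \<And>n. y (r n) \<in> B (r n)\<rbrakk> \<Longrightarrow> limitin Y (y \<circ> r) a sequentially"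
    using metrizable_shrinking_balls[OF assms(1)] by metis
  have "\<forall>n. openin Y (B n) \<and> B n \<noteq> {}"
    using B by blast
  then obtain A y where A: "infinite A" "\<forall>n\<in>A. y n \<in> B n"
    and no: "\<not> has_convergent_subsequence_on Y A y"
    using W unfolding WSHD_def by blast
  \<comment> \<open>The increasing enumeration of \<open>A\<close> turns the selection into a
    subsequence of itself.\<close>
  have "strict_mono (enumerate A)" "range (enumerate A) \<subseteq> A"
    using A(1) by (auto simp: strict_mono_enumerate enumerate_in_set)
  then have "has_convergent_subsequence_on Y A y"
    using B(3)[of "enumerate A" y] A(2) unfolding has_convergent_subsequence_on_def by blast
  with no show False ..
qed

text \<open>Without isolated points the centre can be removed from the balls, which excludes constant
  selections.\<close>

lemma metrizable_imp_not_discretely_selective: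
  assumes "metrizable_space Y" "a \<in> topspace Y" "\<not> openin Y {a}"
  shows "\<not> discretely_selective Y"
proof
  assume D: "discretely_selective Y"
  obtain B :: "nat \<Rightarrow> 'a set" where B: "\<And>n. openin Y (B n)" "\<And>n. a \<in> B n"
    "\<And>r y. \<lbrakk>strict_mono r; \<And>n. y (r n) \<in> B (r n)\<rbrakk> \<Longrightarrow> limitin Y (y \<circ> r) a sequentially"
    using metrizable_shrinking_balls[OF assms(1,2)] by metis
  have "closedin Y {a}"
    using metrizable_imp_t1_space[OF assms(1)] assms(2) by (simp add: t1_space_closedin_singleton)
  then have "openin Y (B n - {a})" for n
    using B(1) by (intro openin_diff)
  moreover have "B n - {a} \<noteq> {}" for n
  proof
    assume "B n - {a} = {}"
    with B(2)[of n] have "B n = {a}"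
      by blast
    with B(1)[of n] assms(3) show False
      by simp
  qed
  ultimately have "\<exists>y. (\<forall>n. y n \<in> B n - {a}) \<and> closed_relatively_discrete Y (range y)"
    using D[unfolded discretely_selective_def, rule_format, of "\<lambda>n. B n - {a}"] by simp
  then obtain y where y: "\<And>n. y n \<in> B n - {a}" and cd: "closed_relatively_discrete Y (range y)"
    by blast
  \<comment> \<open>The limit must lie in the closed range, yet \<open>a\<close> was removed from
    every ball.\<close>
  have "limitin Y y a sequentially"
    using B(3)[of id y] y by (simp add: strict_mono_def o_def)
  then have "a \<in> range y"
    using cd limitin_closedin[of Y y a sequentially "range y"]
    by (simp add: closed_relatively_discrete_def)
  with y show False
    by blast
qed

section \<open>Implications between the selection properties\<close>

text \<open>The limit of a convergent subsequence would lie in the closed range; relative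
  discreteness then makes the subsequence eventually constant, against injectivity.\<close>

lemma injectively_discretely_selective_imp_SHD:
  assumes "injectively_discretely_selective Y"
  shows "SHD Y"
  unfolding SHD_def
proof (intro allI impI)
  fix U :: "nat \<Rightarrow> 'a set"
  assume "\<forall>n. openin Y (U n) \<and> U n \<noteq> {}"
  then obtain y where y: "\<forall>n. y n \<in> U n" "inj y" and cl: "closedin Y (range y)"
    and disc: "\<And>z. z \<in> range y \<Longrightarrow> \<exists>V. openin Y V \<and> V \<inter> range y = {z}"
    using assms unfolding injectively_discretely_selective_def closed_relatively_discrete_def
    by metis
  have False if r: "strict_mono r" and lim: "limitin Y (y \<circ> r) l sequentially" for r :: "nat \<Rightarrow> nat" and l
  proof -
    have "l \<in> range y"
      using limitin_closedin[OF lim cl] by simp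
    then obtain V where V: "openin Y V" "V \<inter> range y = {l}"
      using disc by blast
    then obtain n where n: "\<And>m. m \<ge> n \<Longrightarrow> y (r m) \<in> V"
      using lim unfolding limitin_def eventually_sequentially by fastforce
    have "y (r n) = l" "y (r (Suc n)) = l"
      using n[of n] n[of "Suc n"] V(2) by auto
    then have "r n = r (Suc n)"
      using y(2) by (metis injD)
    with r show False
      by (metis n_not_Suc_n strict_mono_eq)
  qed
  with y(1) show "\<exists>y. (\<forall>n. y n \<in> U n) \<and> \<not> has_convergent_subsequence_on Y UNIV y"
    unfolding has_convergent_subsequence_on_def by blast
qed

lemma injectively_discretely_selective_imp_discretely_selective:
  assumes "injectively_discretely_selective Y"
  shows "discretely_selective Y"
  unfolding discretely_selective_def
proof (intro allI impI)
  fix U :: "nat \<Rightarrow> 'a set"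
  assume "\<forall>n. openin Y (U n) \<and> U n \<noteq> {}"
  with assms have "\<exists>y. (\<forall>n. y n \<in> U n) \<and> closed_relatively_discrete Y (range y) \<and> inj y"
    unfolding injectively_discretely_selective_def by simp
  then show "\<exists>y. (\<forall>n. y n \<in> U n) \<and> closed_relatively_discrete Y (range y)"
    by blast
qed

lemma SHD_imp_WSHD:
  assumes "SHD Y"
  shows "WSHD Y"
  unfolding WSHD_def
proof (intro allI impI)
  fix U :: "nat \<Rightarrow> 'a set"
  assume "\<forall>n. openin Y (U n) \<and> U n \<noteq> {}"
  with assms have "\<exists>y. (\<forall>n. y n \<in> U n) \<and> \<not> has_convergent_subsequence_on Y UNIV y"
    unfolding SHD_def by simp
  then show "\<exists>A y. infinite A \<and> (\<forall>n\<in>A. y n \<in> U n) \<and> \<not> has_convergent_subsequence_on Y A y"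
    using infinite_UNIV_nat by blast
qed

text \<open>Adding a small positive constant to \<open>f\<close> stays inside any given basic
  neighbourhood and changes \<open>f\<close> at every point of \<open>X\<close>.\<close>

lemma not_openin_Ck_space_singleton:
  assumes "topspace X \<noteq> {}"
  shows "\<not> openin (Ck_space X) {f}"
proof
  assume "openin (Ck_space X) {f}"
  then obtain K \<epsilon> where \<epsilon>: "0 < \<epsilon>" "Ck_nbhd X f K \<epsilon> \<subseteq> {f}" and K: "compactin X K"
    and f: "f \<in> continuous_real_functions X"
    unfolding openin_Ck_space by blast
  define g where "g = restrict (\<lambda>x. f x + \<epsilon> / 2) (topspace X)"
  have "g \<in> continuous_real_functions X"
    unfolding g_def using f
    by (intro continuous_real_functions_restrict continuous_map_add)
      (auto simp: continuous_real_functions_def)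
  then have "g \<in> Ck_nbhd X f K \<epsilon>"
    using \<epsilon>(1) compactin_subset_topspace[OF K] by (auto simp: Ck_nbhd_def g_def)
  with \<epsilon>(2) have "g = f"
    by blast
  moreover obtain x where "x \<in> topspace X"
    using assms by blast
  then have "g x = f x + \<epsilon> / 2"
    by (simp add: g_def)
  ultimately show False
    using \<epsilon>(1) by simp
qed

subsection \<open>Spaces that are not hemicompact\<close>

lemma injective_choice_of_infinite_sets:
  fixes V :: "nat \<Rightarrow> 'b set"
  assumes "\<And>n. infinite (V n)"
  obtains y where "\<And>n. y n \<in> V n" "inj y"
proof -
  have "\<exists>y. \<forall>n. y n \<in> V n \<and> y n \<notin> y ` {..<n}"
  \<comment> \<open>Well-founded choice applies because the condition at \<open>n\<close> involves
    only the values of \<open>y\<close> below \<open>n\<close>, which are finitely many.\<close>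
  proof (rule dependent_wf_choice[of less_than "\<lambda>y n z. z \<in> V n \<and> z \<notin> y ` {..<n}"])
    fix n and y :: "nat \<Rightarrow> 'b"
    have "infinite (V n - y ` {..<n})"
      using assms by (simp add: Diff_infinite_finite)
    then show "\<exists>z. z \<in> V n \<and> z \<notin> y ` {..<n}"
      by (metis DiffE ex_in_conv finite.emptyI)
  qed auto
  then obtain y where y: "\<And>n. y n \<in> V n" "\<And>n. y n \<notin> y ` {..<n}"
    by blast
  then have "inj y"
    by (intro linorder_injI) (metis imageI lessThan_iff)
  with y(1) that show thesis
    by blast
qed

lemma closed_relatively_discrete_if_locally_finite:
  assumes t1: "t1_space Y" and sub: "A \<subseteq> topspace Y"
    and loc: "\<And>z. z \<in> topspace Y \<Longrightarrow> \<exists>V. openin Y V \<and> z \<in> V \<and> finite (V \<inter> A)"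
  shows "closed_relatively_discrete Y A"
proof -
  \<comment> \<open>Finite sets are closed, so the other points of \<open>A\<close> can be removed
    from the neighbourhood. For \<open>z\<close> outside \<open>A\<close> this gives closedness, for
    \<open>z\<close> in \<open>A\<close> discreteness.\<close>
  have *: "\<exists>W. openin Y W \<and> z \<in> W \<and> W \<inter> A \<subseteq> {z}" if z: "z \<in> topspace Y" for z
  proof -
    obtain V where V: "openin Y V" "z \<in> V" "finite (V \<inter> A)"
      using loc[OF z] by blast
    have "closedin Y (V \<inter> A - {z})"
      using t1 V(3) sub by (intro t1_space_closedin_finite[THEN iffD1, rule_format]) auto
    then have "openin Y (V - (V \<inter> A - {z}))"
      using V(1) by (intro openin_diff)
    with V(2) show ?thesis
      by (intro exI[of _ "V - (V \<inter> A - {z})"]) auto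
  qed
  have "openin Y (topspace Y - A)"
  proof (subst openin_subopen, intro ballI)
    fix z assume "z \<in> topspace Y - A"
    with *[of z] show "\<exists>T. openin Y T \<and> z \<in> T \<and> T \<subseteq> topspace Y - A"
      using openin_subset by fast
  qed
  then have "closedin Y A"
    using sub by (simp add: closedin_def)
  moreover have "\<exists>W. openin Y W \<and> W \<inter> A = {z}" if "z \<in> A" for z
    using *[of z] that sub by blast
  ultimately show ?thesis
    by (simp add: closed_relatively_discrete_def)
qed

text \<open>Distinct extensional functions differ at a point of the carrier, and this point is a
  compact set on which to separate them.\<close>

lemma t1_space_Ck_space: "t1_space (Ck_space X)"
  unfolding t1_space_def
proof (intro ballI impI)
  fix f g assume fg: "f \<in> topspace (Ck_space X)" "g \<in> topspace (Ck_space X)" "f \<noteq> g"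
  then obtain x where x: "x \<in> topspace X" "f x \<noteq> g x"
    unfolding topspace_Ck_space continuous_real_functions_def
    by (blast intro: extensionalityI)
  have "openin (Ck_space X) (Ck_nbhd X f {x} \<bar>g x - f x\<bar>)"
    using x fg by (intro openin_Ck_nbhd) auto
  moreover have "f \<in> Ck_nbhd X f {x} \<bar>g x - f x\<bar>" "g \<notin> Ck_nbhd X f {x} \<bar>g x - f x\<bar>"
    using x fg by (auto simp: Ck_nbhd_def)
  ultimately show "\<exists>U. openin (Ck_space X) U \<and> f \<in> U \<and> g \<notin> U"
    by blast
qed

text \<open>Adding multiples of a continuous function that vanishes on \<open>K\<close> but not at
  \<open>x\<close> gives any value at \<open>x\<close> without changing \<open>f\<close> on
  \<open>K\<close>. Infinitely many solutions are wanted so that later choices can be made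
  distinct.\<close>

lemma Ck_nbhd_large_value_infinite:
  assumes X: "tychonoff_space X" and K: "compactin X K" and x: "x \<in> topspace X - K"
    and f: "f \<in> continuous_real_functions X" and "0 < \<epsilon>"
  shows "infinite {g \<in> Ck_nbhd X f K \<epsilon>. b \<le> g x}"
proof -
  have "Hausdorff_space X"
    using X completely_regular_imp_regular_space regular_t1_imp_Hausdorff_space
    unfolding tychonoff_space_def by blast
  then have "closedin X K"
    using K by (rule compactin_imp_closedin)
  then obtain h where h: "continuous_map X euclideanreal h" "h x = 1" "\<And>z. z \<in> K \<Longrightarrow> h z = 0"
  proof -
    obtain h where "continuous_map X (top_of_set {0..1::real}) h" "h x = 0" "h ` K \<subseteq> {1}"
      using X \<open>closedin X K\<close> x unfolding tychonoff_space_def completely_regular_space_def by metis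
    then show thesis
      \<comment> \<open>Complete regularity gives 0 at the point and 1 on the closed set;
        \<open>1 - h\<close> exchanges the two values.\<close>
      by (intro that[of "\<lambda>z. 1 - h z"] continuous_map_diff)
        (auto simp: continuous_map_in_subtopology)
  qed
  \<comment> \<open>\<open>g t\<close> takes the value \<open>t\<close> at \<open>x\<close>, so
    different \<open>t\<close> give different functions.\<close>
  define g where "g t = restrict (\<lambda>z. f z + (t - f x) * h z) (topspace X)" for t
  have gx: "g t x = t" for t
    using x h(2) by (simp add: g_def)
  have "g t \<in> continuous_real_functions X" for t
    unfolding g_def using f h(1)
    by (intro continuous_real_functions_restrict continuous_map_add continuous_map_real_mult)
      (auto simp: continuous_real_functions_def)
  then have "g t \<in> Ck_nbhd X f K \<epsilon>" for t
    using compactin_subset_topspace[OF K] h(3) \<open>0 < \<epsilon>\<close> by (auto simp: Ck_nbhd_def g_def)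
  then have "g ` {b..} \<subseteq> {g \<in> Ck_nbhd X f K \<epsilon>. b \<le> g x}"
    using gx by auto
  moreover have "inj g"
    using gx by (metis injI)
  then have "infinite (g ` {b..})"
    using infinite_Ici[of b] by (simp add: finite_image_iff inj_on_subset)
  ultimately show ?thesis
    using finite_subset by blast
qed

lemma not_hemicompact_imp_injectively_discretely_selective:
  assumes X: "tychonoff_space X" and nh: "\<not> hemicompact_space X"
  shows "injectively_discretely_selective (Ck_space X)"
  unfolding injectively_discretely_selective_def
proof (intro allI impI)
  fix U :: "nat \<Rightarrow> ('a \<Rightarrow> real) set"
  assume U: "\<forall>n. openin (Ck_space X) (U n) \<and> U n \<noteq> {}"
  have "\<exists>f K \<epsilon>. f \<in> continuous_real_functions X \<and> compactin X K \<and> 0 < \<epsilon> \<and> Ck_nbhd X f K \<epsilon> \<subseteq> U n" for n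
    using U unfolding openin_Ck_space by (metis ex_in_conv subsetD)
  then obtain f K \<epsilon> where f: "\<And>n. f n \<in> continuous_real_functions X"
    and K: "\<And>n. compactin X (K n)" and \<epsilon>: "\<And>n. 0 < \<epsilon> n"
    and sub: "\<And>n. Ck_nbhd X (f n) (K n) (\<epsilon> n) \<subseteq> U n"
    by metis
  \<comment> \<open>Otherwise the countable family of all \<open>K n\<close> would witness
    hemicompactness.\<close>
  have "\<exists>C. compactin X C \<and> (\<forall>n. \<not> C \<subseteq> K n)"
  proof (rule ccontr)
    assume "\<not> ?thesis"
    then have "hemicompact_space X"
      using K unfolding hemicompact_space_def by (intro exI[of _ "range K"]) auto
    with nh show False ..
  qed
  then obtain C where C: "compactin X C" and notin: "\<And>n. \<not> C \<subseteq> K n"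
    by blast
  have "\<forall>n. \<exists>z. z \<in> C - K n"
    using notin by blast
  then obtain x where x: "\<And>n. x n \<in> C - K n"
    by (auto dest!: choice)
  have CX: "C \<subseteq> topspace X"
    using C by (rule compactin_subset_topspace)
  \<comment> \<open>The lower bound \<open>real n\<close> grows while the points \<open>x n\<close>
    all stay in the single compact set \<open>C\<close>.\<close>
  define V where "V n = {g \<in> Ck_nbhd X (f n) (K n) (\<epsilon> n). real n \<le> g (x n)}" for n
  have "infinite (V n)" for n
    unfolding V_def using x[of n] CX by (intro Ck_nbhd_large_value_infinite X K f \<epsilon>) auto
  then obtain y where y: "\<And>n. y n \<in> V n" and "inj y"
    by (rule injective_choice_of_infinite_sets[where V = V]) blast
  have "closed_relatively_discrete (Ck_space X) (range y)"
  proof (rule closed_relatively_discrete_if_locally_finite[OF t1_space_Ck_space])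
    show "range y \<subseteq> topspace (Ck_space X)"
      using y by (auto simp: V_def Ck_nbhd_def)
    fix g assume "g \<in> topspace (Ck_space X)"
    then have g: "g \<in> continuous_real_functions X"
      by simp
    then have "compactin euclideanreal (g ` C)"
      using C by (intro image_compactin) (auto simp: continuous_real_functions_def)
    then have "bdd_above (g ` C)"
      by (simp add: bounded_imp_bdd_above compact_imp_bounded)
    then obtain b where b: "\<And>z. z \<in> C \<Longrightarrow> g z \<le> b"
      by (auto simp: bdd_above_def)
    \<comment> \<open>A function within 1 of \<open>g\<close> on \<open>C\<close> stays below
      \<open>b + 1\<close> there, whereas \<open>y n\<close> reaches \<open>n\<close> at
      \<open>x n\<close>; this bounds \<open>n\<close>.\<close>
    have "n \<le> nat \<lceil>b + 1\<rceil>" if "y n \<in> Ck_nbhd X g C 1" for n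
    proof -
      have "\<bar>y n (x n) - g (x n)\<bar> < 1" "g (x n) \<le> b" "real n \<le> y n (x n)"
        using that x[of n] b y[of n] by (auto simp: Ck_nbhd_def V_def)
      then show ?thesis
        by linarith
    qed
    then have "Ck_nbhd X g C 1 \<inter> range y \<subseteq> y ` {..nat \<lceil>b + 1\<rceil>}"
      by auto
    then have "finite (Ck_nbhd X g C 1 \<inter> range y)"
      using finite_subset by blast
    moreover have "g \<in> Ck_nbhd X g C 1"
      using g by (simp add: Ck_nbhd_def)
    ultimately show "\<exists>V. openin (Ck_space X) V \<and> g \<in> V \<and> finite (V \<inter> range y)"
      using openin_Ck_nbhd[OF C g] by blast
  qed
  moreover have "y n \<in> U n" for n
    using y[of n] sub[of n] by (auto simp: V_def)
  ultimately show "\<exists>y. (\<forall>n. y n \<in> U n) \<and> closed_relatively_discrete (Ck_space X) (range y) \<and> inj y"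
    using \<open>inj y\<close> by blast
qed

theorem corollary3p40:
  fixes X :: "'a topology"
  assumes "topspace X \<noteq> {}" and "tychonoff_space X"
  shows "(\<not> hemicompact_space X \<longleftrightarrow> \<not> metrizable_space (Ck_space X)) \<and>
         (\<not> hemicompact_space X \<longleftrightarrow> injectively_discretely_selective (Ck_space X)) \<and>
         (\<not> hemicompact_space X \<longleftrightarrow> discretely_selective (Ck_space X)) \<and>
         (\<not> hemicompact_space X \<longleftrightarrow> SHD (Ck_space X)) \<and>
         (\<not> hemicompact_space X \<longleftrightarrow> WSHD (Ck_space X))"
proof -
  let ?Y = "Ck_space X"
  obtain a where a: "a \<in> topspace ?Y"
    using continuous_real_functions_restrict[of X "\<lambda>_. 0"] by auto
  \<comment> \<open>Two cycles close the equivalence: (i), (iii), (iv), (ii), (i) and (i), (iii),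
    (v), (vi), (ii), (i). The last step, from (ii) to (i), is used in contrapositive form.\<close>
  have "\<not> hemicompact_space X \<Longrightarrow> injectively_discretely_selective ?Y"
    by (rule not_hemicompact_imp_injectively_discretely_selective[OF assms(2)])
  moreover have "injectively_discretely_selective ?Y \<Longrightarrow> discretely_selective ?Y"
    by (rule injectively_discretely_selective_imp_discretely_selective)
  moreover have "discretely_selective ?Y \<Longrightarrow> \<not> metrizable_space ?Y"
    using metrizable_imp_not_discretely_selective[OF _ a not_openin_Ck_space_singleton[OF assms(1)]]
    by blast
  moreover have "injectively_discretely_selective ?Y \<Longrightarrow> SHD ?Y"
    by (rule injectively_discretely_selective_imp_SHD)
  moreover have "SHD ?Y \<Longrightarrow> WSHD ?Y"
    by (rule SHD_imp_WSHD)
  moreover have "WSHD ?Y \<Longrightarrow> \<not> metrizable_space ?Y"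
    using metrizable_imp_not_WSHD[of ?Y] a by blast
  moreover have "hemicompact_space X \<Longrightarrow> metrizable_space ?Y"
    by (rule metrizable_Ck_space[OF assms(1)])
  ultimately show ?thesis
    by blast
qed

end
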